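(* If $Q$ is any basic sequence, then the set of real numbers that are not strongly $Q$-distribution normal is $1/2$-winning.
   Context: A basic sequence is a sequence $Q=\{q_n\}$ of integers $q_n\ge2$. Let $T_{Q,n}(x)=q_1\cdots q_nx\pmod1$. A real $x$ is strongly $Q$-distribution normal if for all positive integers $k$ and all $p\in\{1,\dots,k\}$, the sequence $\{T_{Q,kn+p}(x)\}_{n\ge1}$ is uniformly distributed mod $1$. Schmidt's game on $\mathbb{R}$: Bob picks a closed interval $B_1$, Alice a closed interval $A_1\subset B_1$ with radius $\alpha\rho(B_1)$, Bob $B_2\subset A_1$ with radius $\beta\rho(A_1)$, and so on; a set $T$ is $(\alpha,\beta)$-winning if Alice can force $\bigcap_nB_n\subset T$, and $\alpha$-winning if $(\alpha,\beta)$-winning for all $\beta\in(0,1)$. *)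

theory Defs
  imports "HOL-Analysis.Analysis"
begin

text \<open>Basic sequences are indexed from 1, as in \<open>q\<^sub>1, q\<^sub>2, \<dots>\<close>; the value at 0 is never used.\<close>

definition basic_sequence :: "(nat \<Rightarrow> int) \<Rightarrow> bool" where
  "basic_sequence Q \<longleftrightarrow> (\<forall>n\<ge>1. 2 \<le> Q n)"

definition T_map :: "(nat \<Rightarrow> int) \<Rightarrow> nat \<Rightarrow> real \<Rightarrow> real" where
  "T_map Q n x = frac (of_int (\<Prod>i=1..n. Q i) * x)"

text \<open>Uniform distribution modulo 1 of the sequence \<open>u 1, u 2, \<dots>\<close>.\<close>

definition uniformly_distributed_mod1 :: "(nat \<Rightarrow> real) \<Rightarrow> bool" where
  "uniformly_distributed_mod1 u \<longleftrightarrow>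
     (\<forall>a b. 0 \<le> a \<and> a < b \<and> b \<le> 1 \<longrightarrow>
        (\<lambda>N. real (card {n \<in> {1..N}. frac (u n) \<in> {a..<b}}) / real N) \<longlonglongrightarrow> b - a)"

definition strongly_distribution_normal :: "(nat \<Rightarrow> int) \<Rightarrow> real \<Rightarrow> bool" where
  "strongly_distribution_normal Q x \<longleftrightarrow>
     (\<forall>k\<ge>1. \<forall>p\<in>{1..k}. uniformly_distributed_mod1 (\<lambda>n. T_map Q (k * n + p) x))"

text \<open>A nondegenerate closed interval is encoded by its centre and its (positive) radius.\<close>

type_synonym interval = "real \<times> real"

definition points :: "interval \<Rightarrow> real set" where
  "points I = cball (fst I) (snd I)"

definition radius :: "interval \<Rightarrow> real" where
  "radius I = snd I"

definition legal_reply :: "real \<Rightarrow> interval \<Rightarrow> interval \<Rightarrow> bool" where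
  "legal_reply c I J \<longleftrightarrow> points J \<subseteq> points I \<and> radius J = c * radius I"

text \<open>
  A strategy of Alice maps the nonempty list of Bob's moves so far to her next move.
  Legality is required after every list of moves, not only along infinite plays;
  otherwise Alice could win vacuously by making a move that Bob cannot answer.
\<close>

definition alice_strategy :: "real \<Rightarrow> (interval list \<Rightarrow> interval) \<Rightarrow> bool" where
  "alice_strategy \<alpha> \<sigma> \<longleftrightarrow>
     (\<forall>Bs. Bs \<noteq> [] \<and> radius (last Bs) > 0 \<longrightarrow> legal_reply \<alpha> (last Bs) (\<sigma> Bs))"

text \<open>\<open>B n\<close> is Bob's move number \<open>n + 1\<close>, and Alice answers it with \<open>\<sigma> [B 0, \<dots>, B n]\<close>.\<close>

definition bob_play :: "real \<Rightarrow> (interval list \<Rightarrow> interval) \<Rightarrow> (nat \<Rightarrow> interval) \<Rightarrow> bool" where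
  "bob_play \<beta> \<sigma> B \<longleftrightarrow>
     radius (B 0) > 0 \<and> (\<forall>n. legal_reply \<beta> (\<sigma> (map B [0..<Suc n])) (B (Suc n)))"

definition schmidt_winning :: "real \<Rightarrow> real \<Rightarrow> real set \<Rightarrow> bool" where
  "schmidt_winning \<alpha> \<beta> S \<longleftrightarrow>
     (\<exists>\<sigma>. alice_strategy \<alpha> \<sigma> \<and> (\<forall>B. bob_play \<beta> \<sigma> B \<longrightarrow> (\<Inter>n. points (B n)) \<subseteq> S))"

definition alpha_winning :: "real \<Rightarrow> real set \<Rightarrow> bool" where
  "alpha_winning \<alpha> S \<longleftrightarrow> (\<forall>\<beta>. 0 < \<beta> \<and> \<beta> < 1 \<longrightarrow> schmidt_winning \<alpha> \<beta> S)"

end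

theory Submission
  imports Defs
begin

text \<open>
  For a stride \<open>k\<close> with \<open>2 ^ k \<ge> (2 / \<beta>)\<^sup>2\<close> the numbers \<open>P n = q\<^sub>1 \<cdots> q\<^bsub>kn+1\<^esub>\<close> grow so fast
  that, once Bob's radius \<open>r\<close> has \<open>P n * r \<le> 1/8\<close>, Alice has two consecutive moves to spend on \<open>P n\<close>
  alone. At that scale only one multiple of \<open>1 / P n\<close> is near Bob's interval. Alice takes the half of
  the interval on the other side of its centre, twice in a row; the first move puts the multiple
  outside, the second one leaves a gap proportional to \<open>1 / P n\<close>. Hence the fractional parts of
  \<open>P n * x\<close> eventually avoid a fixed interval \<open>{0..<\<delta>}\<close>.
\<close>

section \<open>Alice's move and the gap it produces\<close>

text \<open>For positive \<open>P\<close> the test on \<open>frac\<close> locates a nearest multiple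
  of \<open>1 / P\<close>: at or left of the centre if it holds, right of the centre
  otherwise.\<close>

definition half_away :: "real \<Rightarrow> interval \<Rightarrow> interval" where
  "half_away P I =
     (if frac (P * fst I) < 1/2 then (fst I + snd I / 2, snd I / 2) else (fst I - snd I / 2, snd I / 2))"

lemma radius_half_away: "radius (half_away P I) = radius I / 2"
  by (simp add: half_away_def radius_def)

lemma legal_reply_half_away: "legal_reply (1/2) I (half_away P I)"
proof -
  have "\<bar>fst I - x\<bar> \<le> snd I"
    if "\<bar>fst I + snd I / 2 - x\<bar> \<le> snd I / 2 \<or> \<bar>fst I - snd I / 2 - x\<bar> \<le> snd I / 2" for x
    using that by linarith
  then show ?thesis
    by (auto simp: legal_reply_def points_def radius_def half_away_def dist_real_def)
qed

lemma mem_points_half_away: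
  assumes "x \<in> points (half_away P I)"
  shows "frac (P * fst I) < 1/2 \<Longrightarrow> fst I \<le> x \<and> x \<le> fst I + snd I"
    and "\<not> frac (P * fst I) < 1/2 \<Longrightarrow> fst I - snd I \<le> x \<and> x \<le> fst I"
  using assms unfolding points_def half_away_def mem_cball dist_real_def
  by (simp_all only: if_True if_False fst_conv snd_conv) linarith+

text \<open>The first integer above \<open>y\<close> is more than 1/2 away. Together with its mirror
  image below, this turns Alice's choice of half into linear inequalities valid for every
  \<open>j\<close>, with no need to name the nearest integer.\<close>

lemma int_cases_frac_less_half:
  fixes y :: real
  assumes "frac y < 1/2"
  shows "of_int j \<le> y \<or> of_int j \<ge> y + 1/2"
proof (cases "j \<le> \<lfloor>y\<rfloor>")
  case False
  then have "real_of_int (\<lfloor>y\<rfloor> + 1) \<le> of_int j" by linarith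
  with assms show ?thesis by (simp add: frac_def)
qed linarith

lemma int_cases_frac_ge_half:
  fixes y :: real
  assumes "\<not> frac y < 1/2"
  shows "of_int j \<ge> y \<or> of_int j \<le> y - 1/2"
proof (cases "j \<le> \<lfloor>y\<rfloor>")
  case True
  then have "real_of_int j \<le> of_int \<lfloor>y\<rfloor>" by linarith
  with assms show ?thesis by (simp add: frac_def)
qed linarith

text \<open>In units of \<open>1 / P\<close> the interval \<open>I\<close> is so short that after
  the first move an integer is either behind the old centre or at least 1/2 - 1/8 ahead. The second
  move takes the half of \<open>J\<close> away from a nearby integer, so a whole radius of
  \<open>J\<close> separates them.\<close>

lemma two_half_away_moves:
  fixes P x :: real
  assumes "P > 0" and small: "P * radius I \<le> 1/8" and "radius J > 0"
    and J: "points J \<subseteq> points (half_away P I)" and x: "x \<in> points (half_away P J)"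
  shows "P * radius J \<le> \<bar>P * x - of_int j\<bar>"
proof -
  define m r m' r' where "m = P * fst I" and "r = P * snd I" and "m' = P * fst J" and "r' = P * snd J"
  define y where "y = P * x"
  have r: "r \<le> 1/8" using small by (simp add: r_def radius_def)
  have "snd J > 0" using assms by (simp add: radius_def)
  then have r': "r' > 0" using \<open>P > 0\<close> by (simp add: r'_def)
  have ends: "fst J - snd J \<in> points (half_away P I)" "fst J + snd J \<in> points (half_away P I)"
    using \<open>snd J > 0\<close> by (auto intro!: subsetD[OF J] simp: points_def[of J] dist_real_def)
  have scale: "P * a \<le> P * b \<longleftrightarrow> a \<le> b" for a b using \<open>P > 0\<close> by simp
  have I1: "m \<le> m' - r' \<and> m' + r' \<le> m + r" if "frac m < 1/2"
    using mem_points_half_away(1)[OF ends(1)] mem_points_half_away(1)[OF ends(2)] that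
    unfolding m_def m'_def r_def r'_def distrib_left[symmetric] right_diff_distrib[symmetric] scale
    by simp
  have I2: "m - r \<le> m' - r' \<and> m' + r' \<le> m" if "\<not> frac m < 1/2"
    using mem_points_half_away(2)[OF ends(1)] mem_points_half_away(2)[OF ends(2)] that
    unfolding m_def m'_def r_def r'_def distrib_left[symmetric] right_diff_distrib[symmetric] scale
    by simp
  have J1: "m' \<le> y \<and> y \<le> m' + r'" if "frac m' < 1/2"
    using mem_points_half_away(1)[OF x] that
    unfolding m'_def r'_def y_def distrib_left[symmetric] right_diff_distrib[symmetric] scale
    by simp
  have J2: "m' - r' \<le> y \<and> y \<le> m'" if "\<not> frac m' < 1/2"
    using mem_points_half_away(2)[OF x] that
    unfolding m'_def r'_def y_def distrib_left[symmetric] right_diff_distrib[symmetric] scale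
    by simp
  have "r' \<le> \<bar>y - of_int j\<bar>"
  \<comment> \<open>An integer ahead of the first half is at least 3/8 from \<open>y\<close>, while
    \<open>r'\<close> is at most 1/16. If the two moves go in opposite directions, an integer behind
    \<open>J\<close> is at least 1/2 from \<open>m'\<close>, hence at least \<open>1/2 - r'\<close>
    from \<open>y\<close>.\<close>
  proof (cases "frac m < 1/2"; cases "frac m' < 1/2")
    assume "frac m < 1/2" "frac m' < 1/2"
    then show ?thesis
      using I1 J1 r r' int_cases_frac_less_half[of m j] int_cases_frac_less_half[of m' j] by linarith
  next
    assume "frac m < 1/2" "\<not> frac m' < 1/2"
    then show ?thesis
      using I1 J2 r r' int_cases_frac_less_half[of m j] int_cases_frac_ge_half[of m' j] by linarith
  next
    assume "\<not> frac m < 1/2" "frac m' < 1/2"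
    then show ?thesis
      using I2 J1 r r' int_cases_frac_ge_half[of m j] int_cases_frac_less_half[of m' j] by linarith
  next
    assume "\<not> frac m < 1/2" "\<not> frac m' < 1/2"
    then show ?thesis
      using I2 J2 r r' int_cases_frac_ge_half[of m j] int_cases_frac_ge_half[of m' j] by linarith
  qed
  then show ?thesis by (simp add: y_def r'_def radius_def)
qed

section \<open>Radii along a play\<close>

lemma radius_bob_play:
  assumes "bob_play \<beta> \<sigma> B" and "\<And>Bs. radius (\<sigma> Bs) = \<alpha> * radius (last Bs)"
  shows "radius (B n) = radius (B 0) * (\<alpha> * \<beta>) ^ n"
proof (induction n)
  case (Suc n)
  have "radius (B (Suc n)) = \<beta> * (\<alpha> * radius (B n))"
    using assms by (simp add: bob_play_def legal_reply_def)
  with Suc show ?case by simp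
qed simp

text \<open>At the first power that brings the product down to \<open>c\<close>, the preceding
  product still exceeds \<open>c\<close>, so less than one factor \<open>t\<close> is lost. This
  picks the round in which Alice starts on a given \<open>P n\<close>.\<close>

lemma exists_first_power_le:
  fixes a c t :: real
  assumes "0 < t" "t < 1" "0 < c" "c < a"
  obtains i where "a * t ^ i \<le> c" and "t * c < a * t ^ i"
proof -
  define i where "i = (LEAST i. a * t ^ i \<le> c)"
  obtain i0 where "t ^ i0 < c / a"
    using real_arch_pow_inv[of "c / a" t] assms by auto
  then have "a * t ^ i0 \<le> c" using assms by (simp add: field_simps)
  then have le: "a * t ^ i \<le> c" unfolding i_def by (rule LeastI)
  \<comment> \<open>\<open>c < a\<close> rules out index 0, so there is a predecessor.\<close>
  have "i \<noteq> 0" using le assms by (intro notI) simp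
  then obtain l where l: "i = Suc l" by (cases i) auto
  have "\<not> a * t ^ l \<le> c" using not_less_Least[of l "\<lambda>i. a * t ^ i \<le> c"] l i_def by auto
  then have "t * c < t * (a * t ^ l)" using assms by simp
  then show ?thesis using le that[of i] l by (simp add: mult.left_commute)
qed

section \<open>Failure of uniform distribution\<close>

text \<open>Only terms before \<open>n0\<close> can hit \<open>{0..<\<delta>}\<close>, so its
  frequency tends to 0 instead of \<delta>.\<close>

lemma not_uniformly_distributed_mod1_if_avoids_0:
  assumes "0 < \<delta>" "\<delta> \<le> 1" and avoid: "\<And>n. n \<ge> n0 \<Longrightarrow> frac (u n) \<ge> \<delta>"
  shows "\<not> uniformly_distributed_mod1 u"
proof
  assume "uniformly_distributed_mod1 u"
  then have lim: "(\<lambda>N. real (card {n \<in> {1..N}. frac (u n) \<in> {0..<\<delta>}}) / real N) \<longlonglongrightarrow> \<delta>"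
    using assms unfolding uniformly_distributed_mod1_def by fastforce
  have "card {n \<in> {1..N}. frac (u n) \<in> {0..<\<delta>}} \<le> n0" for N
  proof -
    have "{n \<in> {1..N}. frac (u n) \<in> {0..<\<delta>}} \<subseteq> {..<n0}"
      using avoid by (force simp: not_le[symmetric])
    from card_mono[OF _ this] show ?thesis by simp
  qed
  then have "real (card {n \<in> {1..N}. frac (u n) \<in> {0..<\<delta>}}) / real N \<le> real n0 / real N" for N
    by (intro divide_right_mono) auto
  moreover have "(\<lambda>N. real n0 / real N) \<longlonglongrightarrow> 0" by (rule lim_const_over_n)
  ultimately have "\<delta> \<le> 0" using lim by (intro LIMSEQ_le[OF lim]) auto
  with assms show False by simp
qed

section \<open>The winning strategy\<close>

text \<open>Each round scales the radius by \<open>t = \<beta> / 2\<close>, so for large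
  \<open>n\<close> the product \<open>P n * r\<close> spends two consecutive rounds above
  \<open>t\<^sup>2 / 8\<close> and at most 1/8. The growth condition makes these windows disjoint
  for different \<open>n\<close>. The gap is the lower end of the window.\<close>

lemma schmidt_winning_avoids_integers:
  fixes P :: "nat \<Rightarrow> real"
  assumes \<beta>: "0 < \<beta>" "\<beta> < 1" and P0: "P 0 > 0"
    and growth: "\<And>n. P n \<le> (\<beta> / 2)\<^sup>2 * P (Suc n)"
  shows "schmidt_winning (1/2) \<beta>
    {x. \<exists>n0. \<forall>n\<ge>n0. \<forall>j::int. (\<beta> / 2)\<^sup>2 / 8 \<le> \<bar>P n * x - of_int j\<bar>}"
proof -
  define t where "t = \<beta> / 2"
  have t: "0 < t" "t < 1" "t\<^sup>2 > 0" "t\<^sup>2 < 1"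
    using \<beta> by (auto simp: t_def power_less_one_iff)
  have pos: "P n > 0" for n
  proof (induction n)
    case (Suc n)
    then have "t\<^sup>2 * P (Suc n) > 0" using growth[of n] by (simp add: t_def)
    with t show ?case by (simp add: zero_less_mult_iff)
  qed (fact P0)
  have step: "P n \<le> t\<^sup>2 * P (Suc n)" for n using growth by (simp add: t_def)
  have mono: "P n \<le> P n'" if "n \<le> n'" for n n'
  proof (rule lift_Suc_mono_le[OF _ that])
    fix n show "P n \<le> P (Suc n)"
      using step[of n] mult_right_mono[of "t\<^sup>2" 1 "P (Suc n)"] pos[of "Suc n"] t by linarith
  qed
  have jump: "P m \<le> t\<^sup>2 * P n" if "m < n" for m n
    using step[of m] mult_left_mono[OF mono[of "Suc m" n], of "t\<^sup>2"] that t(3) by linarith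
  \<comment> \<open>Hence for large \<open>n\<close> the product \<open>P n * r\<close> starts above
    1/8, and the play passes through the whole window of \<open>n\<close>.\<close>
  have unbounded: "\<exists>n0. \<forall>n\<ge>n0. a < P n" for a
  proof -
    have pow: "P 0 \<le> (t\<^sup>2) ^ n * P n" for n
    proof (induction n)
      case (Suc n)
      also have "(t\<^sup>2) ^ n * P n \<le> (t\<^sup>2) ^ n * (t\<^sup>2 * P (Suc n))"
        using step[of n] t by (intro mult_left_mono) auto
      finally show ?case by (simp add: mult_ac)
    qed simp
    obtain n0 where n0: "(t\<^sup>2) ^ n0 < P 0 / (\<bar>a\<bar> + 1)"
      using real_arch_pow_inv[of "P 0 / (\<bar>a\<bar> + 1)" "t\<^sup>2"] P0 t by auto
    have "a < P n0"
    proof (rule ccontr)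
      assume "\<not> a < P n0"
      then have "(t\<^sup>2) ^ n0 * P n0 \<le> (t\<^sup>2) ^ n0 * (\<bar>a\<bar> + 1)"
        using t by (intro mult_left_mono) auto
      also have "\<dots> < P 0" using n0 by (simp add: field_simps)
      finally show False using pow[of n0] by simp
    qed
    then show ?thesis using mono by (meson less_le_trans)
  qed
  \<comment> \<open>Bob's last radius alone tells which \<open>P n\<close> is due. Outside all
    windows any index will do, since \<open>half_away\<close> is legal for every
    \<open>P\<close>.\<close>
  define idx where "idx r = (LEAST n. P n * r > t\<^sup>2 / 8)" for r
  define \<sigma> where "\<sigma> Bs = half_away (P (idx (radius (last Bs)))) (last Bs)" for Bs
  have idx: "idx r = n" if "P n * r \<le> 1/8" "P n * r > t\<^sup>2 / 8" "r > 0" for n r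
    unfolding idx_def
  proof (rule Least_equality)
    fix m assume m: "P m * r > t\<^sup>2 / 8"
    show "n \<le> m"
    proof (rule ccontr)
      assume "\<not> n \<le> m"
      \<comment> \<open>By \<open>jump\<close>, a smaller index falls short of the lower end of the
        window.\<close>
      then have "P m * r \<le> t\<^sup>2 * P n * r"
        using jump[of m n] that by (intro mult_right_mono) auto
      also have "\<dots> \<le> t\<^sup>2 * (1/8)"
        using mult_left_mono[OF that(1), of "t\<^sup>2"] by (simp add: mult.assoc)
      finally show False using m by simp
    qed
  qed (use that in simp)
  have strat: "alice_strategy (1/2) \<sigma>"
    by (simp add: alice_strategy_def \<sigma>_def legal_reply_half_away)
  have win: "\<exists>n0. \<forall>n\<ge>n0. \<forall>j::int. t\<^sup>2 / 8 \<le> \<bar>P n * x - of_int j\<bar>"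
    if B: "bob_play \<beta> \<sigma> B" and x: "\<And>i. x \<in> points (B i)" for B x
  proof -
    have "radius (\<sigma> Bs) = 1/2 * radius (last Bs)" for Bs
      by (simp add: \<sigma>_def radius_half_away)
    then have rad: "radius (B i) = radius (B 0) * t ^ i" for i
      using radius_bob_play[OF B, of "1/2" i] by (simp add: t_def)
    have r0: "radius (B 0) > 0" using B by (simp add: bob_play_def)
    have rpos: "radius (B i) > 0" for i using r0 t unfolding rad[of i] by simp
    have sub: "points (B (Suc i)) \<subseteq> points (half_away (P (idx (radius (B i)))) (B i))" for i
      using B by (auto simp: bob_play_def legal_reply_def \<sigma>_def)
    obtain n0 where n0: "\<And>n. n \<ge> n0 \<Longrightarrow> 1 / (8 * radius (B 0)) < P n"
      using unbounded by blast
    have "t\<^sup>2 / 8 \<le> \<bar>P n * x - of_int j\<bar>" if "n \<ge> n0" for n and j :: int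
    proof -
      have "1/8 < P n * radius (B 0)" using n0[OF that] r0 by (simp add: field_simps)
      from exists_first_power_le[OF t(1,2) _ this]
      obtain i where "P n * radius (B 0) * t ^ i \<le> 1/8" "t * (1/8) < P n * radius (B 0) * t ^ i"
        by auto
      then have i: "P n * radius (B i) \<le> 1/8" "t * (1/8) < P n * radius (B i)"
        by (simp_all add: rad[of i] mult.assoc)
      \<comment> \<open>The lower bound \<open>t / 8\<close> at round \<open>i\<close> leaves room
        for one more factor \<open>t\<close>, so the next round is still in the window of
        \<open>n\<close>.\<close>
      have radS: "radius (B (Suc i)) = t * radius (B i)"
        by (simp add: rad[of i] rad[of "Suc i"])
      have "t * (t * (1/8)) < t * (P n * radius (B i))"
        using i(2) t by (intro mult_strict_left_mono) auto
      then have lowS: "t\<^sup>2 / 8 < P n * radius (B (Suc i))"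
        by (simp add: radS power2_eq_square mult_ac)
      have "t * (t * (1/8)) \<le> t * (1/8)" using t by (simp add: mult_left_le)
      then have low: "t\<^sup>2 / 8 < P n * radius (B i)" using i by (simp add: power2_eq_square)
      have "t * (P n * radius (B i)) \<le> 1 * (P n * radius (B i))"
        using t pos[of n] rpos[of i] by (intro mult_right_mono) auto
      then have upS: "P n * radius (B (Suc i)) \<le> 1/8"
        using i by (simp add: radS mult_ac)
      have "points (B (Suc i)) \<subseteq> points (half_away (P n) (B i))"
        using sub[of i] idx[OF i(1) low rpos] by simp
      \<comment> \<open>Bob's move after the second answer contains \<open>x\<close> and lies inside
        that answer.\<close>
      moreover have "x \<in> points (half_away (P n) (B (Suc i)))"
        using sub[of "Suc i"] idx[OF upS lowS rpos] x[of "Suc (Suc i)"] by auto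
      ultimately have "P n * radius (B (Suc i)) \<le> \<bar>P n * x - of_int j\<bar>"
        using two_half_away_moves[OF pos i(1) rpos] by blast
      with lowS show ?thesis by simp
    qed
    then show ?thesis by blast
  qed
  show ?thesis
    unfolding schmidt_winning_def t_def[symmetric]
  proof (intro exI[of _ \<sigma>] conjI allI impI subsetI CollectI strat)
    fix B x assume B: "bob_play \<beta> \<sigma> B" and x: "x \<in> (\<Inter>n. points (B n))"
    show "\<exists>n0. \<forall>n\<ge>n0. \<forall>j::int. t\<^sup>2 / 8 \<le> \<bar>P n * x - of_int j\<bar>"
      by (rule win[OF B]) (use x in auto)
  qed
qed

section \<open>Application to basic sequences\<close>

lemma schmidt_winning_mono:
  "schmidt_winning \<alpha> \<beta> S \<Longrightarrow> S \<subseteq> S' \<Longrightarrow> schmidt_winning \<alpha> \<beta> S'"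
  unfolding schmidt_winning_def by (meson subset_trans)

lemma basic_sequence_prod_growth:
  assumes "basic_sequence Q"
  shows "(\<Prod>i=1..m. Q i) > 0" and "2 ^ k * (\<Prod>i=1..m. Q i) \<le> (\<Prod>i=1..m + k. Q i)"
proof -
  have Q: "Q (Suc n) \<ge> 2" for n using assms by (simp add: basic_sequence_def)
  have pos: "(\<Prod>i=1..m. Q i) > 0" for m
    using assms by (intro prod_pos) (force simp: basic_sequence_def)
  then show "(\<Prod>i=1..m. Q i) > 0" .
  show "2 ^ k * (\<Prod>i=1..m. Q i) \<le> (\<Prod>i=1..m + k. Q i)"
  proof (induction k)
    case (Suc k)
    then have "2 ^ Suc k * (\<Prod>i=1..m. Q i) \<le> 2 * (\<Prod>i=1..m + k. Q i)" by simp
    also have "\<dots> \<le> Q (Suc (m + k)) * (\<Prod>i=1..m + k. Q i)"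
      using Q pos by (intro mult_right_mono) (auto intro: less_imp_le)
    finally show ?case by (simp add: mult.commute)
  qed simp
qed

theorem theorem3p15:
  fixes Q :: "nat \<Rightarrow> int"
  assumes "basic_sequence Q"
  shows "alpha_winning (1/2) {x. \<not> strongly_distribution_normal Q x}"
  unfolding alpha_winning_def
proof (intro allI impI, elim conjE)
  fix \<beta> :: real assume \<beta>: "0 < \<beta>" "\<beta> < 1"
  define \<delta> where "\<delta> = (\<beta> / 2)\<^sup>2 / 8"
  have "(\<beta> / 2)\<^sup>2 \<le> 1" using \<beta> by (intro power_le_one) auto
  with \<beta> have \<delta>: "0 < \<delta>" "\<delta> \<le> 1" by (auto simp: \<delta>_def)
  obtain k0 where k0: "(2 / \<beta>)\<^sup>2 < 2 ^ k0"
    using real_arch_pow[of 2 "(2 / \<beta>)\<^sup>2"] by auto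
  \<comment> \<open>\<open>Suc\<close> makes \<open>k \<ge> 1\<close> evident, as a stride must
    be.\<close>
  define k where "k = Suc k0"
  have "(2 / \<beta>)\<^sup>2 \<le> 2 ^ k" using k0 zero_le_power2[of "2 / \<beta>"] unfolding k_def power_Suc by linarith
  then have k: "1 \<le> (\<beta> / 2)\<^sup>2 * 2 ^ k" using \<beta> by (simp add: power_divide field_simps)
  \<comment> \<open>The offset is \<open>p = 1\<close>; one bad pair of stride and offset already
    refutes strong normality.\<close>
  define P where "P n = real_of_int (\<Prod>i=1..k * n + 1. Q i)" for n
  have pos: "P n > 0" for n
    unfolding P_def of_int_0_less_iff by (rule basic_sequence_prod_growth(1)[OF assms])
  have growth: "P n \<le> (\<beta> / 2)\<^sup>2 * P (Suc n)" for n
  proof -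
    have "k * Suc n + 1 = k * n + 1 + k" by simp
    then have "2 ^ k * (\<Prod>i=1..k * n + 1. Q i) \<le> (\<Prod>i=1..k * Suc n + 1. Q i)"
      using basic_sequence_prod_growth(2)[OF assms, where m = "k * n + 1"] by metis
    then have "real_of_int (2 ^ k * (\<Prod>i=1..k * n + 1. Q i)) \<le> P (Suc n)"
      unfolding P_def of_int_le_iff .
    then have "2 ^ k * P n \<le> P (Suc n)"
      unfolding P_def of_int_mult of_int_power of_int_numeral .
    then have "(\<beta> / 2)\<^sup>2 * (2 ^ k * P n) \<le> (\<beta> / 2)\<^sup>2 * P (Suc n)"
      by (intro mult_left_mono) auto
    moreover have "P n \<le> (\<beta> / 2)\<^sup>2 * 2 ^ k * P n"
      using mult_right_mono[OF k, of "P n"] pos[of n] by simp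
    ultimately show ?thesis by (simp add: mult.assoc)
  qed
  have "\<not> strongly_distribution_normal Q x"
    if far: "\<And>n j. n \<ge> n0 \<Longrightarrow> \<delta> \<le> \<bar>P n * x - of_int j\<bar>" for x n0
  proof -
    \<comment> \<open>The distance from \<open>P n * x\<close> to its floor is its fractional
      part.\<close>
    have "frac (T_map Q (k * n + 1) x) \<ge> \<delta>" if "n \<ge> n0" for n
      using far[OF that, of "\<lfloor>P n * x\<rfloor>"] frac_ge_0[of "P n * x"]
      by (simp add: T_map_def P_def frac_def)
    then have "\<not> uniformly_distributed_mod1 (\<lambda>n. T_map Q (k * n + 1) x)"
      by (rule not_uniformly_distributed_mod1_if_avoids_0[OF \<delta>])
    moreover have "k \<ge> 1" "1 \<in> {1..k}" by (simp_all add: k_def)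
    ultimately show ?thesis
      unfolding strongly_distribution_normal_def by blast
  qed
  then have "{x. \<exists>n0. \<forall>n\<ge>n0. \<forall>j::int. \<delta> \<le> \<bar>P n * x - of_int j\<bar>}
      \<subseteq> {x. \<not> strongly_distribution_normal Q x}" by blast
  with schmidt_winning_avoids_integers[of \<beta> P, OF \<beta> pos growth]
  show "schmidt_winning (1/2) \<beta> {x. \<not> strongly_distribution_normal Q x}"
    unfolding \<delta>_def by (rule schmidt_winning_mono)
qed

end
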